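(* For every real $K>0$ there is an integer $m\ge 2$ such that $\pi^-\bigl(S_2(m,0)\bigr)>K$. One may take any integer $L>2K$ and then $m=2^{L^2}+1$.
   Context: For $m\ge2$, $S_2(m,0)=\{X\subseteq[m]:|X|\le2\}$, ordered by inclusion. A family $\mathcal G$ of sets is a weak copy of a finite poset $(P,\leqslant)$ if there is a bijection $\psi:P\to\mathcal G$ such that $\psi(p)\subseteq\psi(p')$ whenever $p\leqslant p'$. A family $\mathcal F$ is (weak) $P$-free if no subfamily of it is a weak copy of $P$. $\mathrm{La}(n,P)$ is the maximum size of a weak $P$-free family $\mathcal F\subseteq 2^{[n]}$, where $[n]=\{1,\dots,n\}$, and $\pi^-(P)=\liminf_{n\to\infty}\mathrm{La}(n,P)/\binom{n}{\lfloor n/2\rfloor}$. *)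

theory Defs
  imports "HOL-Library.Extended_Real" "HOL-Library.Liminf_Limsup"
begin

text \<open>A poset is a pair of a carrier set \<open>P\<close> and a relation \<open>r\<close> satisfying
  \<open>partial_order_on P r\<close>.\<close>

definition weak_copy :: "'a set \<Rightarrow> 'a rel \<Rightarrow> 'b set set \<Rightarrow> bool" where
  "weak_copy P r G \<longleftrightarrow>
     (\<exists>\<psi>. bij_betw \<psi> P G \<and> (\<forall>p\<in>P. \<forall>p'\<in>P. (p, p') \<in> r \<longrightarrow> \<psi> p \<subseteq> \<psi> p'))"

definition weak_free :: "'a set \<Rightarrow> 'a rel \<Rightarrow> 'b set set \<Rightarrow> bool" where
  "weak_free P r F \<longleftrightarrow> \<not> (\<exists>G\<subseteq>F. weak_copy P r G)"

definition La :: "nat \<Rightarrow> 'a set \<Rightarrow> 'a rel \<Rightarrow> nat" where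
  "La n P r = Max {card F | F :: nat set set. F \<subseteq> Pow {1..n} \<and> weak_free P r F}"

text \<open>The lower limit is taken in the extended reals, so it is defined without
  any boundedness condition.\<close>

definition pi_minus :: "'a set \<Rightarrow> 'a rel \<Rightarrow> ereal" where
  "pi_minus P r = liminf (\<lambda>n. ereal (real (La n P r) / real (n choose (n div 2))))"

definition S2 :: "nat \<Rightarrow> nat set set" where
  "S2 m = {X. X \<subseteq> {1..m} \<and> card X \<le> 2}"

definition S2_order :: "nat \<Rightarrow> nat set rel" where
  "S2_order m = {(X, Y). X \<in> S2 m \<and> Y \<in> S2 m \<and> X \<subseteq> Y}"

lemma finite_S2: "finite (S2 m)"
  by (rule finite_subset[of _ "Pow {1..m}"]) (auto simp: S2_def)

lemma S2_nonempty: "S2 m \<noteq> {}"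
  unfolding S2_def by (auto intro!: exI[of _ "{}"])

lemma partial_order_on_S2: "partial_order_on (S2 m) (S2_order m)"
  unfolding partial_order_on_def preorder_on_def S2_order_def
  by (auto simp: refl_on_def trans_def antisym_def)

text \<open>The maximum in \<^const>\<open>La\<close> ranges over a finite set, which is nonempty when the
  poset is: the empty family is then free.\<close>

lemma finite_La_set:
  "finite {card F | F :: nat set set. F \<subseteq> Pow {1..n} \<and> weak_free P r F}"
proof -
  have "finite (card ` Pow (Pow {1..n}))" by simp
  then show ?thesis by (rule rev_finite_subset) blast
qed

lemma La_set_nonempty:
  assumes "P \<noteq> {}"
  shows "{card F | F :: nat set set. F \<subseteq> Pow {1..n} \<and> weak_free P r F} \<noteq> {}"
proof -
  have "weak_free P r ({} :: nat set set)"
    using assms by (auto simp: weak_free_def weak_copy_def bij_betw_def)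
  then show ?thesis by blast
qed

end

theory Submission
  imports Defs "HOL-Library.FuncSet" "HOL-Library.Z2" "HOL-Library.Function_Algebras" "HOL-Real_Asymp.Real_Asymp"
begin

text \<open>Label the points of \<open>{1..n}\<close> by vectors of $F_2^r$ with \<open>r = n div 2 + 1\<close> and keep those sets of
  the levels \<open>r - L, \<dots>, r - 1\<close> whose labels are linearly independent. In such a family let \<open>A\<close> be the
  image of \<open>{}\<close> in a copy of \<open>S2 m\<close>. The span of the labels of \<open>A\<close> has at most $2^L$ cosets, so there
  are at most $2^{L^2}$ possibilities for the set of cosets met by the labels of \<open>\<psi> {i} - A\<close>, and two
  indices \<open>i \<noteq> j\<close> share the same one. Since the labels of \<open>\<psi> {i, j}\<close>, a superset of \<open>\<psi> {i} \<union> \<psi> {j}\<close>,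
  are independent, points outside \<open>A\<close> are determined by their cosets, whence \<open>\<psi> {i} = \<psi> {j}\<close>.
  For a random labelling a given set of size less than \<open>r\<close> is dependent with probability at most
  one half, by a union bound over its nonempty subsets, so some labelling keeps half of the
  \<open>L\<close> central levels.\<close>

section \<open>Linear algebra over the two-element field\<close>

text \<open>Where every label satisfies \<open>g + g = 0\<close>, linear combinations are subset
  sums, so this is linear independence of the labels as a family indexed by
  \<open>X\<close>.\<close>

definition indep :: "('a \<Rightarrow> 'g::ab_group_add) \<Rightarrow> 'a set \<Rightarrow> bool" where
  "indep v X \<longleftrightarrow> (\<forall>T\<subseteq>X. T \<noteq> {} \<longrightarrow> sum v T \<noteq> 0)"

lemma indep_subset: "indep v Y \<Longrightarrow> X \<subseteq> Y \<Longrightarrow> indep v X"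
  unfolding indep_def by blast

text \<open>This is F_2^r given by its additive group. A carrier set is used because the dimension
  varies with \<open>n\<close>, which a type cannot do.\<close>

locale binary_space =
  fixes V :: "'g::ab_group_add set" and r :: nat
  assumes zero_mem: "0 \<in> V"
    and add_mem: "g \<in> V \<Longrightarrow> h \<in> V \<Longrightarrow> g + h \<in> V"
    and add_self: "g \<in> V \<Longrightarrow> g + g = 0"
    and card_V: "card V = 2 ^ r"
begin

lemma finite_V: "finite V"
  using card_V by (intro card_ge_0_finite) simp

lemma sum_mem: "v ` T \<subseteq> V \<Longrightarrow> sum v T \<in> V"
  by (induction T rule: infinite_finite_induct) (auto simp: zero_mem add_mem)

lemma uminus_eq: "g \<in> V \<Longrightarrow> - g = g"
  using add_self by (simp add: neg_eq_iff_add_eq_0)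

lemma sum_sym_diff:
  assumes "finite S" "finite T" "v ` (S \<union> T) \<subseteq> V"
  shows "sum v (sym_diff S T) = sum v S + sum v T"
proof -
  have "sum v (S \<inter> T) \<in> V"
    by (rule sum_mem) (use assms in auto)
  then have "sum v (S \<inter> T) + sum v (S \<inter> T) = 0"
    by (rule add_self)
  moreover have "sum v S = sum v (S - T) + sum v (S \<inter> T)"
    using assms(1) by (metis sum.Int_Diff add.commute)
  moreover have "sum v T = sum v (T - S) + sum v (S \<inter> T)"
    using assms(2) by (metis sum.Int_Diff add.commute Int_commute)
  moreover have "sum v (sym_diff S T) = sum v (S - T) + sum v (T - S)"
    by (rule sum.union_disjoint) (use assms in auto)
  ultimately show ?thesis
    by (simp add: add.assoc add.left_commute)
qed

text \<open>Two subsets with equal sums have a symmetric difference of sum zero, which independence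
  forces to be empty.\<close>

lemma inj_on_sum_Pow:
  assumes "finite A" "v ` A \<subseteq> V" "indep v A"
  shows "inj_on (sum v) (Pow A)"
proof (rule inj_onI)
  fix S T assume ST: "S \<in> Pow A" "T \<in> Pow A" "sum v S = sum v T"
  then have "finite S" "finite T" "v ` (S \<union> T) \<subseteq> V"
    using assms(1,2) finite_subset by auto
  then have "sum v (sym_diff S T) = sum v T + sum v T"
    using ST(3) by (simp add: sum_sym_diff)
  also have "\<dots> = 0"
    by (rule add_self, rule sum_mem) (use ST assms(2) in auto)
  finally have "sym_diff S T = {}"
    using assms(3) ST(1,2) unfolding indep_def by (metis Pow_iff Un_least Diff_subset subset_trans)
  then show "S = T" by blast
qed

text \<open>This is Lagrange's theorem. Cosets that meet are equal because \<open>W\<close> contains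
  differences: each element of \<open>V\<close> is its own negative.\<close>

lemma card_cosets:
  assumes W: "W \<subseteq> V" "0 \<in> W" "\<And>g h. g \<in> W \<Longrightarrow> h \<in> W \<Longrightarrow> g + h \<in> W"
  shows "card W * card ((\<lambda>g. (+) g ` W) ` V) = 2 ^ r"
proof -
  have "card W * card ((\<lambda>g. (+) g ` W) ` V) = card (\<Union>g\<in>V. (+) g ` W)"
  proof (rule card_partition)
    show "finite (\<Union>g\<in>V. (+) g ` W)"
      using finite_V W(1) by (auto intro: finite_subset)
    show "card c = card W" if "c \<in> (\<lambda>g. (+) g ` W) ` V" for c
      using that by (auto simp: card_image)
    have sub: "(+) g ` W \<subseteq> (+) h ` W"
      if "g + a = h + b" "a \<in> W" "b \<in> W" for g h a b
    proof (clarify)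
      fix w assume "w \<in> W"
      have "g = h + (b - a)" using that(1) by (simp add: algebra_simps)
      moreover have "b - a = b + a" using uminus_eq[of a] that W(1) by (metis diff_conv_add_uminus subsetD)
      ultimately have "g + w = h + (b + a + w)" by (simp add: algebra_simps)
      then show "g + w \<in> (+) h ` W" using \<open>w \<in> W\<close> that W(3) by blast
    qed
    show "c \<inter> d = {}" if cd: "c \<in> (\<lambda>g. (+) g ` W) ` V" "d \<in> (\<lambda>g. (+) g ` W) ` V" "c \<noteq> d" for c d
    proof (rule ccontr)
      assume "c \<inter> d \<noteq> {}"
      then obtain g h a b where gh: "c = (+) g ` W" "d = (+) h ` W" "g + a = h + b" "a \<in> W" "b \<in> W"
        using cd(1,2) by (smt (verit) disjoint_iff imageE)
      then have "c = d" using sub[of g a h b] sub[of h b g a] by auto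
      with cd(3) show False ..
    qed
  qed (use finite_V in simp)
  also have "(\<Union>g\<in>V. (+) g ` W) = V"
  proof
    show "(\<Union>g\<in>V. (+) g ` W) \<subseteq> V" using W(1) add_mem by blast
    show "V \<subseteq> (\<Union>g\<in>V. (+) g ` W)" using W(2) by force
  qed
  finally show ?thesis by (simp add: card_V)
qed

text \<open>The subset sums of \<open>A\<close> form the span of its labels: symmetric differences
  give closure under addition, and independence gives \<open>2 ^ card A\<close> distinct
  sums.\<close>

lemma card_cosets_sums:
  assumes "finite A" "v ` A \<subseteq> V" "indep v A"
  shows "2 ^ card A * card ((\<lambda>g. (\<lambda>T. g + sum v T) ` Pow A) ` V) = 2 ^ r"
proof -
  have *: "card (sum v ` Pow A) * card ((\<lambda>g. (+) g ` sum v ` Pow A) ` V) = 2 ^ r"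
  proof (rule card_cosets)
    show "sum v ` Pow A \<subseteq> V" using assms(2) by (auto intro!: sum_mem)
    show "0 \<in> sum v ` Pow A" by (rule image_eqI[of _ _ "{}"]) auto
    fix g h assume "g \<in> sum v ` Pow A" "h \<in> sum v ` Pow A"
    then obtain S T where ST: "S \<subseteq> A" "T \<subseteq> A" "g = sum v S" "h = sum v T" by auto
    then have "g + h = sum v (sym_diff S T)"
      using assms(1,2) by (subst sum_sym_diff) (auto intro: finite_subset)
    then show "g + h \<in> sum v ` Pow A" using ST by blast
  qed
  have "card (sum v ` Pow A) = 2 ^ card A"
    using inj_on_sum_Pow[OF assms] assms(1) by (simp add: card_image card_Pow)
  with * show ?thesis by (simp add: image_image)
qed

text \<open>Equal cosets give \<open>v b = v b' + sum v T\<close> with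
  \<open>T \<subseteq> A\<close>; if \<open>b \<noteq> b'\<close>, then \<open>b\<close>,
  \<open>b'\<close> and \<open>T\<close> together have sum zero.\<close>

lemma indep_coset_eq_imp_eq:
  assumes "finite A" "v ` insert b (insert b' A) \<subseteq> V" "indep v (insert b (insert b' A))"
    and "b \<notin> A" "b' \<notin> A"
    and "(\<lambda>T. v b + sum v T) ` Pow A = (\<lambda>T. v b' + sum v T) ` Pow A"
  shows "b = b'"
proof (rule ccontr)
  assume "b \<noteq> b'"
  have "v b \<in> (\<lambda>T. v b + sum v T) ` Pow A"
    by (rule image_eqI[of _ _ "{}"]) auto
  then obtain T where T: "T \<subseteq> A" "v b = v b' + sum v T"
    using assms(6) by auto
  have "finite T" "b \<notin> T" "b' \<notin> T" using T(1) assms(1,4,5) finite_subset by auto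
  then have "sum v (insert b (insert b' T)) = v b + (v b' + sum v T)"
    using \<open>b \<noteq> b'\<close> by simp
  also have "\<dots> = 0" using T(2) add_self assms(2) by simp
  finally show False
    using assms(3) T(1) unfolding indep_def by (metis insert_mono insert_not_empty)
qed

end

section \<open>Families of independent sets without a copy of \<open>S2 m\<close>\<close>

text \<open>A nonempty set of size at most \<open>L\<close> can be listed with length exactly
  \<open>L\<close> by repeating one of its elements.\<close>

lemma card_nonempty_subsets_le:
  assumes "finite Q"
  shows "card {S. S \<subseteq> Q \<and> S \<noteq> {} \<and> card S \<le> L} \<le> card Q ^ L"
proof -
  have "{S. S \<subseteq> Q \<and> S \<noteq> {} \<and> card S \<le> L} \<subseteq> set ` {xs. set xs \<subseteq> Q \<and> length xs = L}"
  proof (clarify)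
    fix S assume S: "S \<subseteq> Q" "S \<noteq> {}" "card S \<le> L"
    then obtain x where "x \<in> S" by blast
    obtain ys where ys: "set ys = S" "length ys = card S"
      using S(1) assms finite_distinct_list distinct_card by (metis finite_subset)
    have "set (ys @ replicate (L - card S) x) = S" "length (ys @ replicate (L - card S) x) = L"
      using ys S \<open>x \<in> S\<close> by (auto simp: set_replicate_conv_if)
    then show "S \<in> set ` {xs. set xs \<subseteq> Q \<and> length xs = L}"
      using S(1) by (metis (mono_tags, lifting) imageI mem_Collect_eq)
  qed
  then have "card {S. S \<subseteq> Q \<and> S \<noteq> {} \<and> card S \<le> L} \<le> card {xs. set xs \<subseteq> Q \<and> length xs = L}"
    by (rule surj_card_le[OF finite_lists_length_eq[OF assms]])
  then show ?thesis using card_lists_length_eq[OF assms] by simp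
qed

context binary_space
begin

text \<open>The size bounds serve twice: the labels of the bottom set span a space of codimension at
  most \<open>L\<close>, and each \<open>\<psi> {i}\<close> exceeds the bottom set by at most
  \<open>L\<close> points.\<close>

lemma weak_free_indep:
  fixes v :: "'a \<Rightarrow> 'g"
  assumes fin: "finite E" and v: "v ` E \<subseteq> V"
    and F: "\<And>X. X \<in> F \<Longrightarrow> X \<subseteq> E \<and> indep v X \<and> r \<le> card X + L \<and> card X \<le> r"
    and m: "m > 2 ^ (L ^ 2)"
  shows "weak_free (S2 m) (S2_order m) F"
  unfolding weak_free_def
proof (rule notI, elim exE conjE)
  fix G assume "G \<subseteq> F" "weak_copy (S2 m) (S2_order m) G"
  then obtain \<psi> where bij: "bij_betw \<psi> (S2 m) G"
    and mono: "\<And>p q. p \<in> S2 m \<Longrightarrow> q \<in> S2 m \<Longrightarrow> p \<subseteq> q \<Longrightarrow> \<psi> p \<subseteq> \<psi> q"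
    unfolding weak_copy_def S2_order_def by (elim exE conjE) simp
  have F\<psi>: "\<psi> p \<in> F" if "p \<in> S2 m" for p
    using bij that \<open>G \<subseteq> F\<close> by (auto simp: bij_betw_def)
  have S2: "{} \<in> S2 m" "\<And>i. i \<in> {1..m} \<Longrightarrow> {i} \<in> S2 m"
    "\<And>i j. i \<in> {1..m} \<Longrightarrow> j \<in> {1..m} \<Longrightarrow> {i, j} \<in> S2 m"
    by (auto simp: S2_def card_insert_if)
  define A where "A = \<psi> {}"
  define B where "B i = \<psi> {i} - A" for i
  \<comment> \<open>\<open>C g\<close> is the coset of \<open>g\<close> modulo the span of the
    labels of \<open>A\<close>, and \<open>Q\<close> is the quotient space.\<close>
  define C where "C g = (\<lambda>T. g + sum v T) ` Pow A" for g
  define Q where "Q = C ` V"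
  have A: "A \<subseteq> E" "indep v A" "r \<le> card A + L" "card A \<le> r"
    using F[OF F\<psi>[OF S2(1)]] by (auto simp: A_def)
  have finA: "finite A" using A(1) fin by (rule finite_subset)
  have "2 ^ card A * card Q = (2::nat) ^ r"
    unfolding Q_def C_def using finA A v by (intro card_cosets_sums) auto
  also have "\<dots> \<le> 2 ^ (card A + L)" by (intro power_increasing A) auto
  finally have cardQ: "card Q \<le> 2 ^ L" by (simp add: power_add)
  have finQ: "finite Q" using finite_V by (simp add: Q_def)
  have sing: "A \<subseteq> \<psi> {i}" "\<psi> {i} \<noteq> A" "\<psi> {i} \<subseteq> E" "card (\<psi> {i}) \<le> r" if "i \<in> {1..m}" for i
  proof -
    show "A \<subseteq> \<psi> {i}" unfolding A_def using S2 that by (intro mono) auto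
    show "\<psi> {i} \<noteq> A" unfolding A_def using bij S2 that
      by (metis bij_betw_imp_inj_on inj_onD insert_not_empty)
    show "\<psi> {i} \<subseteq> E" "card (\<psi> {i}) \<le> r" using F[OF F\<psi>[OF S2(2)[OF that]]] by auto
  qed
  \<comment> \<open>Nonemptiness comes from the injectivity of \<open>\<psi>\<close>, which makes
    \<open>\<psi> {i}\<close> a proper superset of \<open>A\<close>.\<close>
  have image: "C ` v ` B i \<in> {S. S \<subseteq> Q \<and> S \<noteq> {} \<and> card S \<le> L}" if i: "i \<in> {1..m}" for i
  proof -
    have "finite (\<psi> {i})" using sing(3)[OF i] fin by (rule finite_subset)
    then have finB: "finite (B i)" by (simp add: B_def)
    have "card (C ` v ` B i) \<le> card (B i)"
      using finB by (simp add: image_image card_image_le)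
    also have "\<dots> = card (\<psi> {i}) - card A"
      unfolding B_def using finA sing(1)[OF i] by (rule card_Diff_subset)
    also have "\<dots> \<le> L" using sing(4)[OF i] A(3) by linarith
    finally show ?thesis
      using sing[OF i] v by (auto simp: B_def Q_def)
  qed
  \<comment> \<open>The count is at most \<open>(2 ^ L) ^ L = 2 ^ (L ^ 2)\<close>, the source of the
    bound on \<open>m\<close>.\<close>
  have "card ((\<lambda>i. C ` v ` B i) ` {1..m}) \<le> card {S. S \<subseteq> Q \<and> S \<noteq> {} \<and> card S \<le> L}"
    using finQ image by (intro card_mono image_subsetI) auto
  also have "\<dots> \<le> card Q ^ L" using finQ by (rule card_nonempty_subsets_le)
  also have "\<dots> \<le> (2 ^ L) ^ L" using cardQ by (rule power_mono) simp
  also have "\<dots> < card {1..m}" using m by (simp add: power2_eq_square power_mult)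
  finally have "\<not> inj_on (\<lambda>i. C ` v ` B i) {1..m}" by (rule pigeonhole)
  then have "\<exists>i\<in>{1..m}. \<exists>j\<in>{1..m}. C ` v ` B i = C ` v ` B j \<and> i \<noteq> j"
    by (simp only: inj_on_def ball_simps not_imp)
  then obtain i j where ij: "i \<in> {1..m}" "j \<in> {1..m}" "C ` v ` B i = C ` v ` B j" "i \<noteq> j"
    by (elim bexE conjE) (rule that)
  \<comment> \<open>Here the sets \<open>{i, j}\<close> enter: \<open>\<psi> {i, j}\<close> contains
    \<open>A\<close>, \<open>b\<close> and \<open>b'\<close> at once, so these have independent
    labels. One inclusion is enough, as \<open>i\<close> and \<open>j\<close> can be
    swapped.\<close>
  have sub: "B i \<subseteq> B j" if ij: "i \<in> {1..m}" "j \<in> {1..m}" "C ` v ` B i = C ` v ` B j" for i j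
  proof
    fix b assume b: "b \<in> B i"
    then have "C (v b) \<in> C ` v ` B j" unfolding ij(3)[symmetric] by (intro imageI)
    then obtain b' where b': "b' \<in> B j" "C (v b) = C (v b')"
      by (elim imageE) (simp add: that)
    have "\<psi> {i} \<subseteq> \<psi> {i, j}" "\<psi> {j} \<subseteq> \<psi> {i, j}"
      using S2(2)[OF ij(1)] S2(2)[OF ij(2)] S2(3)[OF ij(1,2)] by (intro mono; simp)+
    then have "insert b (insert b' A) \<subseteq> \<psi> {i, j}"
      using b b' sing(1)[OF ij(1)] by (auto simp: B_def)
    moreover have "\<psi> {i, j} \<subseteq> E" "indep v (\<psi> {i, j})"
      using F[OF F\<psi>[OF S2(3)[OF ij(1,2)]]] by auto
    ultimately have ind: "indep v (insert b (insert b' A))" and "insert b (insert b' A) \<subseteq> E"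
      using indep_subset by (blast, order)
    from image_mono[OF this(2)] v have "v ` insert b (insert b' A) \<subseteq> V"
      by (rule subset_trans)
    then have "b = b'"
      using finA ind b b' by (intro indep_coset_eq_imp_eq[of A v b b']) (simp_all add: B_def C_def)
    then show "b \<in> B j" using b' by simp
  qed
  have "B i = B j" using sub[OF ij(1-3)] sub[OF ij(2,1) ij(3)[symmetric]] by simp
  then have "\<psi> {i} = \<psi> {j}"
    using sing(1)[OF ij(1)] sing(1)[OF ij(2)] by (auto simp: B_def)
  then have "{i} = {j}" using bij S2 ij(1,2) by (metis bij_betw_imp_inj_on inj_onD)
  with ij(4) show False by simp
qed

section \<open>Counting labellings\<close>

text \<open>Adding \<open>g\<close> to the label of a fixed \<open>t \<in> T\<close> turns sum zero
  into sum \<open>g\<close>. So \<open>g\<close>, and then \<open>v\<close>, can be recovered from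
  the new labelling, and the \<open>2 ^ r\<close> shifts of the sum-zero labellings are all
  distinct.\<close>

lemma card_sum_eq_0_le:
  fixes E T :: "'a set"
  assumes E: "finite E" and T: "T \<subseteq> E" "T \<noteq> {}"
  shows "card {v \<in> E \<rightarrow>\<^sub>E V. sum v T = 0} * 2 ^ r \<le> card (E \<rightarrow>\<^sub>E V)"
proof -
  obtain t where t: "t \<in> T" using T by auto
  have finT: "finite T" using E T finite_subset by blast
  let ?f = "\<lambda>(v, g). v(t := v t + g)"
  have sum_upd: "sum (v(t := v t + g)) T = g" if "sum v T = 0" for v :: "'a \<Rightarrow> 'g" and g
  proof -
    have "sum (v(t := v t + g)) T = sum (\<lambda>x. v x + (if x = t then g else 0)) T"
      by (rule sum.cong) auto
    also have "\<dots> = g" using finT t that by (simp add: sum.distrib)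
    finally show ?thesis .
  qed
  have "card ({v \<in> E \<rightarrow>\<^sub>E V. sum v T = 0} \<times> V) \<le> card (E \<rightarrow>\<^sub>E V)"
  proof (rule card_inj_on_le)
    show "inj_on ?f ({v \<in> E \<rightarrow>\<^sub>E V. sum v T = 0} \<times> V)"
    proof (rule inj_onI, clarify)
      fix v w :: "'a \<Rightarrow> 'g" and g h
      assume *: "sum v T = 0" "sum w T = 0" "v(t := v t + g) = w(t := w t + h)"
      have gh: "g = h" using sum_upd[OF *(1), of g] sum_upd[OF *(2), of h] *(3) by simp
      have "v x = w x" for x using fun_cong[OF *(3), of x] gh by (auto split: if_splits)
      then show "v = w \<and> g = h" using gh by auto
    qed
    show "?f ` ({v \<in> E \<rightarrow>\<^sub>E V. sum v T = 0} \<times> V) \<subseteq> E \<rightarrow>\<^sub>E V"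
      using t T(1) by (auto simp: PiE_iff extensional_def intro!: add_mem)
    show "finite (E \<rightarrow>\<^sub>E V)" using E finite_V by (simp add: finite_PiE)
  qed
  then show ?thesis by (simp add: card_cartesian_product card_V)
qed

lemma card_indep_ge:
  assumes E: "finite E" and X: "X \<subseteq> E" "card X < r"
  shows "card (E \<rightarrow>\<^sub>E V) \<le> 2 * card {v \<in> E \<rightarrow>\<^sub>E V. indep v X}"
proof -
  let ?O = "E \<rightarrow>\<^sub>E V"
  let ?D = "\<lambda>T. {v \<in> ?O. sum v T = 0}"
  have finO: "finite ?O" using E finite_V by (simp add: finite_PiE)
  have finX: "finite X" using X E finite_subset by blast
  have "2 ^ r * card {v \<in> ?O. \<not> indep v X} \<le> 2 ^ r * card (\<Union>T\<in>Pow X - {{}}. ?D T)"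
    using finX finO by (intro mult_left_mono card_mono finite_UN_I) (auto simp: indep_def)
  also have "\<dots> \<le> 2 ^ r * (\<Sum>T\<in>Pow X - {{}}. card (?D T))"
    using finX by (intro mult_left_mono card_UN_le) auto
  also have "\<dots> = (\<Sum>T\<in>Pow X - {{}}. card (?D T) * 2 ^ r)"
    by (simp add: sum_distrib_left mult.commute)
  also have "\<dots> \<le> (\<Sum>T\<in>Pow X - {{}}. card ?O)"
    using X(1) by (intro sum_mono card_sum_eq_0_le[OF E]) auto
  also have "\<dots> \<le> card (Pow X) * card ?O"
    by (simp add: card_mono finX card_Diff1_le)
  also have "\<dots> = 2 ^ card X * card ?O" using finX by (simp add: card_Pow)
  \<comment> \<open>The extra factor 2 is what the strict inequality \<open>card X < r\<close> pays
    for: \<open>2 ^ Suc (card X) \<le> 2 ^ r\<close>.\<close>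
  finally have "2 * (2 ^ r * card {v \<in> ?O. \<not> indep v X}) \<le> 2 ^ Suc (card X) * card ?O"
    by simp
  also have "\<dots> \<le> 2 ^ r * card ?O"
    using X(2) by (intro mult_right_mono power_increasing) auto
  finally have "2 * card {v \<in> ?O. \<not> indep v X} \<le> card ?O" by (simp add: mult.left_commute)
  moreover have "card ?O = card {v \<in> ?O. indep v X} + card {v \<in> ?O. \<not> indep v X}"
    using finO by (subst card_Un_disjoint[symmetric]) (auto intro!: arg_cong[where f = card])
  ultimately show ?thesis by linarith
qed

text \<open>Averaged over all labellings, at least half of \<open>H\<close> is independent, so some
  labelling does as well as the average; the double count is run by contradiction.\<close>

lemma exists_many_indep:
  assumes E: "finite E" and H: "H \<subseteq> Pow E" "\<And>X. X \<in> H \<Longrightarrow> card X < r"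
  shows "\<exists>v. v ` E \<subseteq> V \<and> card H \<le> 2 * card {X \<in> H. indep v X}"
proof (rule ccontr)
  let ?O = "E \<rightarrow>\<^sub>E V"
  assume contra: "\<not> ?thesis"
  have finO: "finite ?O" using E finite_V by (simp add: finite_PiE)
  have O_ne: "?O \<noteq> {}" using zero_mem by (auto simp: PiE_eq_empty_iff)
  have finH: "finite H" using H(1) E by (auto intro: finite_subset)
  have "card H * card ?O = (\<Sum>X\<in>H. card ?O)" by simp
  also have "\<dots> \<le> (\<Sum>X\<in>H. 2 * card {v \<in> ?O. indep v X})"
    using H by (intro sum_mono card_indep_ge E) auto
  also have "\<dots> = 2 * (\<Sum>X\<in>H. \<Sum>v\<in>?O. if indep v X then 1 else 0)"
    using finO by (simp add: sum_distrib_left sum.If_cases Int_def)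
  also have "\<dots> = 2 * (\<Sum>v\<in>?O. \<Sum>X\<in>H. if indep v X then 1 else 0)"
    by (subst sum.swap) simp
  also have "\<dots> = (\<Sum>v\<in>?O. 2 * card {X \<in> H. indep v X})"
    using finH by (simp add: sum_distrib_left sum.If_cases Int_def)
  also have "\<dots> < (\<Sum>v\<in>?O. card H)"
  proof (rule sum_strict_mono[OF finO O_ne])
    fix v assume "v \<in> ?O"
    then have "v ` E \<subseteq> V" by auto
    then show "2 * card {X \<in> H. indep v X} < card H" using contra by (meson not_le)
  qed
  finally show False by (simp add: mult.commute)
qed

end

section \<open>The lower bound for \<open>La\<close>\<close>

text \<open>Indicator functions with values in \<open>bit\<close> realise F_2^r inside one type for
  all \<open>r\<close>; addition corresponds to symmetric difference.\<close>

lemma binary_space_bit: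
  "binary_space ((\<lambda>S i. if i \<in> S then 1 else 0 :: bit) ` Pow {..<r}) r" (is "binary_space (?f ` _) r")
proof
  have "inj_on ?f (Pow {..<r})"
    by (rule inj_onI) (metis (mono_tags, lifting) zero_neq_one subsetI subset_antisym)
  then show "card (?f ` Pow {..<r}) = 2 ^ r" by (simp add: card_image card_Pow)
  show "0 \<in> ?f ` Pow {..<r}" by (rule image_eqI[of _ _ "{}"]) auto
next
  fix g h assume "g \<in> ?f ` Pow {..<r}" "h \<in> ?f ` Pow {..<r}"
  then obtain S T where ST: "S \<subseteq> {..<r}" "T \<subseteq> {..<r}" "g = ?f S" "h = ?f T" by auto
  show "g + h \<in> ?f ` Pow {..<r}"
    by (rule image_eqI[of _ _ "sym_diff S T"]) (use ST in \<open>auto simp: fun_eq_iff\<close>)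
next
  fix g assume "g \<in> ?f ` Pow {..<r}"
  show "g + g = 0" by (simp add: fun_eq_iff)
qed

lemma La_ge:
  "F \<subseteq> Pow {1..n} \<Longrightarrow> weak_free P r F \<Longrightarrow> card F \<le> La n P r"
  unfolding La_def by (rule Max_ge[OF finite_La_set]) auto

text \<open>The assumption keeps \<open>k - j\<close> from being truncated, so the levels are
  distinct and hence disjoint.\<close>

lemma card_consecutive_levels:
  assumes "L \<le> k + 1"
  shows "card {X. X \<subseteq> {1..n::nat} \<and> k < card X + L \<and> card X \<le> k} = (\<Sum>j<L. n choose (k - j))"
proof -
  have "{X. X \<subseteq> {1..n} \<and> k < card X + L \<and> card X \<le> k} = (\<Union>j<L. {X. X \<subseteq> {1..n} \<and> card X = k - j})"
  proof (intro subset_antisym subsetI)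
    fix X assume X: "X \<in> {X. X \<subseteq> {1..n} \<and> k < card X + L \<and> card X \<le> k}"
    then show "X \<in> (\<Union>j<L. {X. X \<subseteq> {1..n} \<and> card X = k - j})"
      by (intro UN_I[of "k - card X"]) auto
  qed (use assms in auto)
  also have "card \<dots> = (\<Sum>j<L. card {X. X \<subseteq> {1..n} \<and> card X = k - j})"
    using assms by (intro card_UN_disjoint) auto
  also have "\<dots> = (\<Sum>j<L. n choose (k - j))" by (simp add: n_subsets)
  finally show ?thesis .
qed

lemma La_S2_ge:
  assumes m: "m > 2 ^ (L ^ 2)" and L: "L \<le> k + 1"
  shows "(\<Sum>j<L. n choose (k - j)) \<le> 2 * La n (S2 m) (S2_order m)"
proof -
  \<comment> \<open>The dimension is one more than the top level \<open>k\<close>: all sizes stay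
    below it, as \<open>exists_many_indep\<close> demands, and \<open>k < card X + L\<close> reads
    \<open>k + 1 \<le> card X + L\<close>.\<close>
  define V where "V = (\<lambda>S i. if i \<in> S then 1 else 0 :: bit) ` Pow {..<k + 1}"
  interpret binary_space V "k + 1" unfolding V_def by (rule binary_space_bit)
  define H where "H = {X. X \<subseteq> {1..n} \<and> k < card X + L \<and> card X \<le> k}"
  obtain v where v: "v ` {1..n} \<subseteq> V" "card H \<le> 2 * card {X \<in> H. indep v X}"
    using exists_many_indep[of "{1..n}" H] by (auto simp: H_def)
  have "weak_free (S2 m) (S2_order m) {X \<in> H. indep v X}"
    by (rule weak_free_indep[OF _ v(1) _ m]) (auto simp: H_def)
  then have "card {X \<in> H. indep v X} \<le> La n (S2 m) (S2_order m)"
    by (intro La_ge) (auto simp: H_def)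
  with v(2) show ?thesis using card_consecutive_levels[OF L, of n] by (simp add: H_def)
qed

section \<open>Asymptotics near the central binomial coefficient\<close>

text \<open>Neighbouring coefficients have quotient \<open>?q n\<close>, which tends to 1; the
  induction multiplies \<open>j\<close> such quotients.\<close>

lemma tendsto_central_binomial_ratio:
  "(\<lambda>n. real (n choose (n div 2 - j)) / real (n choose (n div 2))) \<longlonglongrightarrow> 1"
proof (induction j)
  case 0
  have "n choose (n div 2) \<noteq> 0" for n by simp
  then show ?case by simp
next
  case (Suc j)
  let ?q = "\<lambda>n. real (n div 2 - j) / real (n - n div 2 + j + 1)"
  have q: "?q \<longlonglongrightarrow> 1"
  proof (rule tendsto_sandwich)
    show "\<forall>\<^sub>F n in sequentially. (real n / 2 - 1 - real j) / (real n / 2 + real j + 2) \<le> ?q n"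
      by (intro always_eventually allI frac_le) (auto simp: field_simps)
    show "\<forall>\<^sub>F n in sequentially. ?q n \<le> 1"
      by (intro always_eventually allI) (auto simp: field_simps)
    show "(\<lambda>n. (real n / 2 - 1 - real j) / (real n / 2 + real j + 2)) \<longlonglongrightarrow> 1"
      by real_asymp
  qed simp
  have "\<forall>\<^sub>F n in sequentially. real (n choose (n div 2 - j)) / real (n choose (n div 2)) * ?q n =
      real (n choose (n div 2 - Suc j)) / real (n choose (n div 2))"
  \<comment> \<open>From here on \<open>Suc j \<le> n div 2\<close>, so subtracting
    \<open>Suc j\<close> is not truncated.\<close>
  proof (rule eventually_sequentiallyI[of "2 * j + 2"])
    fix n :: nat assume n: "2 * j + 2 \<le> n"
    define k where "k = n div 2 - Suc j"
    have k: "n div 2 - j = Suc k" "n - n div 2 + j + 1 = n - k" "k < n"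
      using n by (auto simp: k_def)
    have "Suc k * (n choose Suc k) = (n - k) * (n choose k)"
      using k(3) binomial_absorb_comp[of n k] binomial_absorption[of k n] by simp
    then have "real (Suc k) * real (n choose Suc k) = real (n - k) * real (n choose k)"
      by (metis of_nat_mult)
    then have "real (n choose Suc k) * (real (Suc k) / real (n - k)) = real (n choose k)"
      using k(3) by (simp add: field_simps)
    then show "real (n choose (n div 2 - j)) / real (n choose (n div 2)) * ?q n =
      real (n choose (n div 2 - Suc j)) / real (n choose (n div 2))"
      unfolding k k_def[symmetric] by (simp add: field_simps)
  qed
  from tendsto_cong[THEN iffD1, OF this tendsto_mult[OF Suc.IH q]] show ?case by simp
qed

text \<open>Each of the \<open>L\<close> levels is asymptotically as large as the central one, and
  \<open>La_S2_ge\<close> secures half of their total.\<close>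

lemma pi_minus_S2_ge:
  assumes m: "m > 2 ^ (L ^ 2)"
  shows "ereal (real L / 2) \<le> pi_minus (S2 m) (S2_order m)"
proof -
  let ?a = "\<lambda>n. (\<Sum>j<L. real (n choose (n div 2 - j)) / real (n choose (n div 2))) / 2"
  have "?a \<longlonglongrightarrow> (\<Sum>j<L. 1) / 2"
    by (intro tendsto_intros tendsto_central_binomial_ratio) simp
  then have "(\<lambda>n. ereal (?a n)) \<longlonglongrightarrow> ereal (real L / 2)" by simp
  then have "ereal (real L / 2) = liminf (\<lambda>n. ereal (?a n))"
    by (rule lim_imp_Liminf[OF sequentially_bot, symmetric])
  also have "\<dots> \<le> pi_minus (S2 m) (S2_order m)"
    unfolding pi_minus_def
  \<comment> \<open>For \<open>n\<close> at least \<open>2 * L\<close> there are \<open>L\<close>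
    genuine levels from \<open>n div 2\<close> downwards.\<close>
  proof (rule Liminf_mono, rule eventually_sequentiallyI[of "2 * L"])
    fix n assume "2 * L \<le> n"
    then have "L \<le> n div 2 + 1" by simp
    then have "(\<Sum>j<L. n choose (n div 2 - j)) \<le> 2 * La n (S2 m) (S2_order m)"
      by (rule La_S2_ge[OF m])
    then have "real (\<Sum>j<L. n choose (n div 2 - j)) \<le> real (2 * La n (S2 m) (S2_order m))"
      by (rule of_nat_mono)
    then have "(\<Sum>j<L. real (n choose (n div 2 - j))) \<le> 2 * real (La n (S2 m) (S2_order m))"
      by simp
    from divide_right_mono[OF this, of "2 * real (n choose (n div 2))"]
    show "ereal (?a n) \<le> ereal (real (La n (S2 m) (S2_order m)) / real (n choose (n div 2)))"
      by (simp add: sum_divide_distrib[symmetric] mult.commute)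
  qed
  finally show ?thesis .
qed

theorem theorem4:
  fixes K :: real
  assumes "K > 0"
  shows "(\<exists>m::nat. m \<ge> 2 \<and> pi_minus (S2 m) (S2_order m) > ereal K) \<and>
    (\<forall>L m :: nat. real L > 2 * K \<longrightarrow> m = 2 ^ (L ^ 2) + 1 \<longrightarrow>
       pi_minus (S2 m) (S2_order m) > ereal K)"
proof -
  have main: "pi_minus (S2 (2 ^ (L ^ 2) + 1)) (S2_order (2 ^ (L ^ 2) + 1)) > ereal K"
    if "real L > 2 * K" for L :: nat
  proof -
    have "ereal K < ereal (real L / 2)" using that by simp
    also have "\<dots> \<le> pi_minus (S2 (2 ^ (L ^ 2) + 1)) (S2_order (2 ^ (L ^ 2) + 1))"
      by (rule pi_minus_S2_ge) simp
    finally show ?thesis .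
  qed
  obtain L :: nat where "real L > 2 * K" using reals_Archimedean2 by blast
  then have "\<exists>m::nat. m \<ge> 2 \<and> pi_minus (S2 m) (S2_order m) > ereal K"
    using main[of L] by (intro exI[of _ "2 ^ (L ^ 2) + 1"]) simp
  with main show ?thesis by blast
qed

end
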